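(* Let $\sigma$ be a fuzzy propositional signature and $\mathbf{p}\subseteq\sigma$. For any fuzzy formulas $F$ and $G$ of $\sigma$, any fuzzy conjunction $\otimes$, any fuzzy negation $\neg$, and any interpretation $I$ of $\sigma$: $I$ is a stable model of $F\otimes\neg G$ relative to $\mathbf{p}$ if and only if $I$ is a stable model of $F$ relative to $\mathbf{p}$ and $I\models\neg G$.
   Context: A fuzzy propositional signature $\sigma$ is a set of symbols (fuzzy atoms). Fuzzy formulas of $\sigma$ are built from atoms of $\sigma$ and numeric constants $c\in[0,1]$ using fuzzy negation symbols $\neg$ (unary) and fuzzy conjunction symbols $\otimes$, disjunction symbols $\oplus$ and implication symbols $\rightarrow$ (binary); a formula may use several different operators of each kind. Each symbol is identified with a function on $[0,1]$ (resp. $[0,1]^2\to[0,1]$), where "increasing/decreasing" is non-strict: $\neg$ is decreasing with $\neg(0)=1$, $\neg(1)=0$; $\otimes$ is increasing in both arguments, commutative, associative, $\otimes(1,x)=x$; $\oplus$ is increasing in both arguments, commutative, associative, $\oplus(0,x)=x$; $\rightarrow$ is decreasing in its first and increasing in its second argument, $\rightarrow\!(1,x)=x$ for all $x$, and $\rightarrow\!(0,0)=1$. Also $\otimes_m(x,y)=\min(x,y)$. An interpretation of $\sigma$ is a map $I:\sigma\to[0,1]$. The truth value $\upsilon_I(F)$ is defined by $\upsilon_I(p)=I(p)$, $\upsilon_I(c)=c$, $\upsilon_I(\neg F)=\neg(\upsilon_I(F))$, $\upsilon_I(F\odot G)=\odot(\upsilon_I(F),\upsilon_I(G))$ for $\odot\in\{\otimes,\oplus,\rightarrow\}$.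 $I\models F$ means $\upsilon_I(F)=1$. The reduct $F^I$ of $F$ relative to $I$ is defined recursively: $F^I=F$ if $F$ is an atom or a numeric constant; $(\neg F)^I=\upsilon_I(\neg F)$ (a numeric constant); $(F\odot G)^I=(F^I\odot G^I)\otimes_m\upsilon_I(F\odot G)$ for $\odot\in\{\otimes,\oplus,\rightarrow\}$. For $\mathbf{p}\subseteq\sigma$, $J<^{\mathbf{p}}I$ means $J\ne I$, $J(p)=I(p)$ for all atoms $p\notin\mathbf{p}$, and $J(p)\le I(p)$ for all $p\in\mathbf{p}$. $I$ is a stable model of $F$ relative to $\mathbf{p}$ if $I\models F$ and there is no interpretation $J$ with $J<^{\mathbf{p}}I$ and $J\models F^I$. *)

theory Defs
  imports Complex_Main "HOL-Library.FuncSet"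
begin

text \<open>
  Operators on the unit interval are total functions on the reals that map the interval into
  itself and satisfy the required laws there; their values outside the interval are irrelevant.
\<close>

abbreviation unit_interval :: "real set" where
  "unit_interval \<equiv> {0..1}"

definition fuzzy_negation :: "(real \<Rightarrow> real) \<Rightarrow> bool" where
  "fuzzy_negation n \<longleftrightarrow>
     n \<in> unit_interval \<rightarrow> unit_interval \<and>
     antimono_on unit_interval n \<and>
     n 0 = 1 \<and> n 1 = 0"

definition fuzzy_conjunction :: "(real \<Rightarrow> real \<Rightarrow> real) \<Rightarrow> bool" where
  "fuzzy_conjunction t \<longleftrightarrow>
     t \<in> unit_interval \<rightarrow> unit_interval \<rightarrow> unit_interval \<and>
     (\<forall>y\<in>unit_interval. mono_on unit_interval (\<lambda>x. t x y)) \<and>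
     (\<forall>x\<in>unit_interval. mono_on unit_interval (\<lambda>y. t x y)) \<and>
     (\<forall>x\<in>unit_interval. \<forall>y\<in>unit_interval. t x y = t y x) \<and>
     (\<forall>x\<in>unit_interval. \<forall>y\<in>unit_interval. \<forall>z\<in>unit_interval. t (t x y) z = t x (t y z)) \<and>
     (\<forall>x\<in>unit_interval. t 1 x = x)"

definition fuzzy_disjunction :: "(real \<Rightarrow> real \<Rightarrow> real) \<Rightarrow> bool" where
  "fuzzy_disjunction s \<longleftrightarrow>
     s \<in> unit_interval \<rightarrow> unit_interval \<rightarrow> unit_interval \<and>
     (\<forall>y\<in>unit_interval. mono_on unit_interval (\<lambda>x. s x y)) \<and>
     (\<forall>x\<in>unit_interval. mono_on unit_interval (\<lambda>y. s x y)) \<and>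
     (\<forall>x\<in>unit_interval. \<forall>y\<in>unit_interval. s x y = s y x) \<and>
     (\<forall>x\<in>unit_interval. \<forall>y\<in>unit_interval. \<forall>z\<in>unit_interval. s (s x y) z = s x (s y z)) \<and>
     (\<forall>x\<in>unit_interval. s 0 x = x)"

definition fuzzy_implication :: "(real \<Rightarrow> real \<Rightarrow> real) \<Rightarrow> bool" where
  "fuzzy_implication i \<longleftrightarrow>
     i \<in> unit_interval \<rightarrow> unit_interval \<rightarrow> unit_interval \<and>
     (\<forall>y\<in>unit_interval. antimono_on unit_interval (\<lambda>x. i x y)) \<and>
     (\<forall>x\<in>unit_interval. mono_on unit_interval (\<lambda>y. i x y)) \<and>
     (\<forall>x\<in>unit_interval. i 1 x = x) \<and>
     i 0 0 = 1"

text \<open>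
  Each connective carries the function with which its symbol is identified, so a single formula
  may use several different operators of each kind. The raw datatype does not constrain atoms,
  constants and operators; this is done by the set of formulas of a signature below.
\<close>

datatype 'a formula =
    Atom 'a
  | Const real
  | Neg "real \<Rightarrow> real" "'a formula"
  | Conj "real \<Rightarrow> real \<Rightarrow> real" "'a formula" "'a formula"
  | Disj "real \<Rightarrow> real \<Rightarrow> real" "'a formula" "'a formula"
  | Impl "real \<Rightarrow> real \<Rightarrow> real" "'a formula" "'a formula"

inductive_set fuzzy_formulas :: "'a set \<Rightarrow> 'a formula set" for \<sigma> :: "'a set" where
  Atom: "q \<in> \<sigma> \<Longrightarrow> Atom q \<in> fuzzy_formulas \<sigma>"
| Const: "c \<in> unit_interval \<Longrightarrow> Const c \<in> fuzzy_formulas \<sigma>"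
| Neg: "fuzzy_negation n \<Longrightarrow> F \<in> fuzzy_formulas \<sigma> \<Longrightarrow> Neg n F \<in> fuzzy_formulas \<sigma>"
| Conj: "fuzzy_conjunction t \<Longrightarrow> F \<in> fuzzy_formulas \<sigma> \<Longrightarrow> G \<in> fuzzy_formulas \<sigma>
    \<Longrightarrow> Conj t F G \<in> fuzzy_formulas \<sigma>"
| Disj: "fuzzy_disjunction s \<Longrightarrow> F \<in> fuzzy_formulas \<sigma> \<Longrightarrow> G \<in> fuzzy_formulas \<sigma>
    \<Longrightarrow> Disj s F G \<in> fuzzy_formulas \<sigma>"
| Impl: "fuzzy_implication i \<Longrightarrow> F \<in> fuzzy_formulas \<sigma> \<Longrightarrow> G \<in> fuzzy_formulas \<sigma>
    \<Longrightarrow> Impl i F G \<in> fuzzy_formulas \<sigma>"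

text \<open>
  The extensional function space makes equality of interpretations mean agreement on the
  signature.
\<close>

definition interpretations :: "'a set \<Rightarrow> ('a \<Rightarrow> real) set" where
  "interpretations \<sigma> = \<sigma> \<rightarrow>\<^sub>E unit_interval"

primrec truth_value :: "('a \<Rightarrow> real) \<Rightarrow> 'a formula \<Rightarrow> real" where
  "truth_value I (Atom q) = I q"
| "truth_value I (Const c) = c"
| "truth_value I (Neg n F) = n (truth_value I F)"
| "truth_value I (Conj t F G) = t (truth_value I F) (truth_value I G)"
| "truth_value I (Disj s F G) = s (truth_value I F) (truth_value I G)"
| "truth_value I (Impl i F G) = i (truth_value I F) (truth_value I G)"

definition satisfies :: "('a \<Rightarrow> real) \<Rightarrow> 'a formula \<Rightarrow> bool" where
  "satisfies I F \<longleftrightarrow> truth_value I F = 1"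

primrec reduct :: "'a formula \<Rightarrow> ('a \<Rightarrow> real) \<Rightarrow> 'a formula" where
  "reduct (Atom q) I = Atom q"
| "reduct (Const c) I = Const c"
| "reduct (Neg n F) I = Const (truth_value I (Neg n F))"
| "reduct (Conj t F G) I =
     Conj min (Conj t (reduct F I) (reduct G I)) (Const (truth_value I (Conj t F G)))"
| "reduct (Disj s F G) I =
     Conj min (Disj s (reduct F I) (reduct G I)) (Const (truth_value I (Disj s F G)))"
| "reduct (Impl i F G) I =
     Conj min (Impl i (reduct F I) (reduct G I)) (Const (truth_value I (Impl i F G)))"

definition less_on :: "'a set \<Rightarrow> 'a set \<Rightarrow> ('a \<Rightarrow> real) \<Rightarrow> ('a \<Rightarrow> real) \<Rightarrow> bool" where
  "less_on \<sigma> p J I \<longleftrightarrow> J \<noteq> I \<and> (\<forall>q\<in>\<sigma> - p. J q = I q) \<and> (\<forall>q\<in>p. J q \<le> I q)"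

definition stable_model :: "'a set \<Rightarrow> 'a set \<Rightarrow> 'a formula \<Rightarrow> ('a \<Rightarrow> real) \<Rightarrow> bool" where
  "stable_model \<sigma> p F I \<longleftrightarrow>
     satisfies I F \<and>
     \<not> (\<exists>J\<in>interpretations \<sigma>. less_on \<sigma> p J I \<and> satisfies J (reduct F I))"

lemma fuzzy_conjunction_min: "fuzzy_conjunction min"
  by (auto simp: fuzzy_conjunction_def mono_on_def min_def)

lemma truth_value_in_unit_interval:
  assumes "F \<in> fuzzy_formulas \<sigma>" and "I \<in> interpretations \<sigma>"
  shows "truth_value I F \<in> unit_interval"
  using assms(1)
proof induction
  case (Atom q)
  then show ?case
    using assms(2) by (auto simp: interpretations_def simp del: atLeastAtMost_iff)
qed (auto simp: fuzzy_negation_def fuzzy_conjunction_def fuzzy_disjunction_def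
    fuzzy_implication_def Pi_iff simp del: atLeastAtMost_iff)

lemma reduct_in_fuzzy_formulas:
  assumes "F \<in> fuzzy_formulas \<sigma>" and "I \<in> interpretations \<sigma>"
  shows "reduct F I \<in> fuzzy_formulas \<sigma>"
  using assms(1)
proof induction
  case (Neg n F)
  then show ?case
    using truth_value_in_unit_interval[OF fuzzy_formulas.Neg[OF Neg(1,2)] assms(2)]
    by (auto intro: fuzzy_formulas.Const simp del: atLeastAtMost_iff)
next
  case (Conj t F G)
  then show ?case
    using truth_value_in_unit_interval[OF fuzzy_formulas.Conj[OF Conj(1-3)] assms(2)]
    by (auto intro: fuzzy_formulas.intros fuzzy_conjunction_min simp del: atLeastAtMost_iff)
next
  case (Disj s F G)
  then show ?case
    using truth_value_in_unit_interval[OF fuzzy_formulas.Disj[OF Disj(1-3)] assms(2)]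
    by (auto intro: fuzzy_formulas.intros fuzzy_conjunction_min simp del: atLeastAtMost_iff)
next
  case (Impl i F G)
  then show ?case
    using truth_value_in_unit_interval[OF fuzzy_formulas.Impl[OF Impl(1-3)] assms(2)]
    by (auto intro: fuzzy_formulas.intros fuzzy_conjunction_min simp del: atLeastAtMost_iff)
qed (auto intro: fuzzy_formulas.intros)

end

theory Submission
  imports Defs
begin

text \<open>A fuzzy conjunction takes the value 1 only at (1, 1)
  (\<open>fuzzy_conjunction_eq_1_iff\<close>), so both sides of the equivalence force I to satisfy F
  and the negation of G. The reduct then turns the negation into the constant 1, neutral for the
  conjunction, and the outer \<open>min\<close> caps with 1 as well. Hence the two reducts have the
  same value under every J, and the same J refute stability.\<close>

lemma fuzzy_conjunction_right_neutral:
  assumes "fuzzy_conjunction t" and "x \<in> unit_interval"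
  shows "t x 1 = x"
  using assms by (auto simp: fuzzy_conjunction_def)

text \<open>Raising one argument to the neutral element 1 shows by monotonicity that t x y is at
  most x and at most y.\<close>

lemma fuzzy_conjunction_eq_1_iff:
  assumes t: "fuzzy_conjunction t" and x: "x \<in> unit_interval" and y: "y \<in> unit_interval"
  shows "t x y = 1 \<longleftrightarrow> x = 1 \<and> y = 1"
proof -
  have one: "(1::real) \<in> unit_interval"
    by simp
  have "mono_on unit_interval (t x)" "mono_on unit_interval (\<lambda>z. t z y)"
    using t x y by (simp_all add: fuzzy_conjunction_def del: atLeastAtMost_iff)
  then have "t x y \<le> t x 1" "t x y \<le> t 1 y"
    using x y one by (auto simp: mono_on_def)
  moreover have "t x 1 = x" "t 1 y = y"
    using t x y fuzzy_conjunction_right_neutral by (auto simp: fuzzy_conjunction_def)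
  ultimately show ?thesis
    using x y by auto
qed

theorem theorem8:
  fixes \<sigma> p :: "'a set"
    and F G :: "'a formula"
    and conj_op :: "real \<Rightarrow> real \<Rightarrow> real"
    and neg_op :: "real \<Rightarrow> real"
    and I :: "'a \<Rightarrow> real"
  assumes "p \<subseteq> \<sigma>"
    and "F \<in> fuzzy_formulas \<sigma>" and "G \<in> fuzzy_formulas \<sigma>"
    and "fuzzy_conjunction conj_op" and "fuzzy_negation neg_op"
    and "I \<in> interpretations \<sigma>"
  shows "stable_model \<sigma> p (Conj conj_op F (Neg neg_op G)) I \<longleftrightarrow>
    stable_model \<sigma> p F I \<and> satisfies I (Neg neg_op G)"
proof -
  let ?H = "Conj conj_op F (Neg neg_op G)"
  have sat: "satisfies I ?H \<longleftrightarrow> satisfies I F \<and> satisfies I (Neg neg_op G)"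
    using fuzzy_conjunction_eq_1_iff[OF assms(4)
        truth_value_in_unit_interval[OF assms(2,6)]
        truth_value_in_unit_interval[OF fuzzy_formulas.Neg[OF assms(5,3)] assms(6)]]
    by (simp add: satisfies_def)
  have red: "satisfies J (reduct ?H I) \<longleftrightarrow> satisfies J (reduct F I)"
    if H: "satisfies I ?H" and J: "J \<in> interpretations \<sigma>" for J
  proof -
    \<comment> \<open>Both the neutral law of \<open>conj_op\<close> and dropping \<open>min\<close>
      with 1 rely on this value lying in the unit interval.\<close>
    have J01: "truth_value J (reduct F I) \<in> unit_interval"
      by (rule truth_value_in_unit_interval[OF reduct_in_fuzzy_formulas[OF assms(2,6)] J])
    \<comment> \<open>The two 1s are the values under I, not J, of \<open>Neg neg_op G\<close> and
      \<open>?H\<close>, frozen by the reduct.\<close>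
    have "truth_value J (reduct ?H I) = min (conj_op (truth_value J (reduct F I)) 1) 1"
      using H sat by (simp add: satisfies_def)
    also have "\<dots> = truth_value J (reduct F I)"
      using fuzzy_conjunction_right_neutral[OF assms(4) J01] J01 by simp
    finally show ?thesis
      by (simp add: satisfies_def)
  qed
  show ?thesis
    \<comment> \<open>If I does not satisfy \<open>?H\<close>, both sides fail by
      \<open>sat\<close>; otherwise \<open>red\<close> matches the counterexamples J.\<close>
    using sat red unfolding stable_model_def by blast
qed

end
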